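(* (Rectangular polynomials.) Let $B_1,\dots,B_n\in\mathbb{C}^{p\times m}$, let $q$ be an integer, and let $F(z)=z^{q}\left(z^{-1}B_1+\cdots+z^{-n}B_n\right)$. Let $\rho\ge1$ be an integer such that $\frac{n}{\rho}$ is a natural number, let $a$ be an integer and $\gamma\ge1$ a natural number, and consider $$G(z)=z^{a\rho}\left(z^{-\gamma\rho}\mathbf{B}_1+z^{-2\gamma\rho}\mathbf{B}_2+\cdots+z^{-\frac{n}{\rho}\gamma\rho}\mathbf{B}_{\frac{n}{\rho}}\right).$$ (a) If $p\ge m$, $F$ is in $\mathcal{U}$, and $\mathbf{B}_k=\begin{pmatrix}B_{(k-1)\rho+1}\\ \vdots\\ B_{k\rho}\end{pmatrix}$ for $k=1,\dots,\frac{n}{\rho}$, then the $\rho p\times m$-valued polynomial $G$ is in $\mathcal{U}$. (b) If $m\ge p$, $F$ is in $\mathcal{U}$, and $\mathbf{B}_k=\begin{pmatrix}B_{(k-1)\rho+1}&\cdots&B_{k\rho}\end{pmatrix}$ for $k=1,\dots,\frac{n}{\rho}$, then the $p\times\rho m$-valued polynomial $G$ is in $\mathcal{U}$.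
   Context: With $\mathbb{T}=\{z\in\mathbb{C}:|z|=1\}$, the class $\mathcal{U}$ consists of the $p\times m$-valued rational functions (for any dimensions $p,m$) with $F(z)^*F(z)=I_m$ for all $z\in\mathbb{T}$ if $p\ge m$ (isometry), and $F(z)F(z)^*=I_p$ for all $z\in\mathbb{T}$ if $m\ge p$ (co-isometry). *)

theory Defs
  imports
    "HOL-Computational_Algebra.Fraction_Field"
    "HOL-Computational_Algebra.Polynomial"
    "Jordan_Normal_Form.Matrix"
    "Jordan_Normal_Form.Schur_Decomposition"
begin

text \<open>
  A \<open>p \<times> m\<close>-valued rational function is a \<open>p \<times> m\<close> matrix over the field of fractions
  of the complex polynomials. Evaluation at a point is only meaningful where some representation
  as a quotient of polynomials has a nonvanishing denominator there.
\<close>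

type_synonym rat_fun = "complex poly fract"

definition regular_at :: "rat_fun \<Rightarrow> complex \<Rightarrow> bool" where
  "regular_at r z \<longleftrightarrow> (\<exists>P Q. r = Fract P Q \<and> poly Q z \<noteq> 0)"

definition rat_eval :: "rat_fun \<Rightarrow> complex \<Rightarrow> complex" where
  "rat_eval r z = (THE v. \<exists>P Q. r = Fract P Q \<and> poly Q z \<noteq> 0 \<and> v = poly P z / poly Q z)"

lemma rat_eval_Fract:
  assumes "poly Q z \<noteq> 0"
  shows "rat_eval (Fract P Q) z = poly P z / poly Q z"
  unfolding rat_eval_def
proof (rule the_equality)
  show "\<exists>P' Q'. Fract P Q = Fract P' Q' \<and> poly Q' z \<noteq> 0 \<and> poly P z / poly Q z = poly P' z / poly Q' z"
    using assms by blast
next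
  fix v
  assume "\<exists>P' Q'. Fract P Q = Fract P' Q' \<and> poly Q' z \<noteq> 0 \<and> v = poly P' z / poly Q' z"
  then obtain P' Q' where *: "Fract P Q = Fract P' Q'" "poly Q' z \<noteq> 0" "v = poly P' z / poly Q' z"
    by blast
  have "Q \<noteq> 0" "Q' \<noteq> 0"
    using assms *(2) by auto
  then have "P * Q' = P' * Q"
    using *(1) by (simp add: eq_fract)
  then have "poly P z * poly Q' z = poly P' z * poly Q z"
    by (metis poly_mult)
  then show "v = poly P z / poly Q z"
    using assms *(2,3) by (simp add: frac_eq_eq)
qed

definition mat_regular_at :: "rat_fun mat \<Rightarrow> complex \<Rightarrow> bool" where
  "mat_regular_at F z \<longleftrightarrow> (\<forall>i < dim_row F. \<forall>j < dim_col F. regular_at (F $$ (i, j)) z)"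

definition mat_eval :: "rat_fun mat \<Rightarrow> complex \<Rightarrow> complex mat" where
  "mat_eval F z = map_mat (\<lambda>r. rat_eval r z) F"

definition isometric_on_circle :: "rat_fun mat \<Rightarrow> bool" where
  "isometric_on_circle F \<longleftrightarrow>
     (\<forall>z. cmod z = 1 \<longrightarrow> mat_regular_at F z \<and>
        mat_adjoint (mat_eval F z) * mat_eval F z = 1\<^sub>m (dim_col F))"

definition coisometric_on_circle :: "rat_fun mat \<Rightarrow> bool" where
  "coisometric_on_circle F \<longleftrightarrow>
     (\<forall>z. cmod z = 1 \<longrightarrow> mat_regular_at F z \<and>
        mat_eval F z * mat_adjoint (mat_eval F z) = 1\<^sub>m (dim_row F))"

definition class_U :: "rat_fun mat set" where
  "class_U = {F. (dim_row F \<ge> dim_col F \<longrightarrow> isometric_on_circle F) \<and>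
                 (dim_col F \<ge> dim_row F \<longrightarrow> coisometric_on_circle F)}"

definition rat_z :: rat_fun where
  "rat_z = Fract [:0, 1:] 1"

definition const_mat :: "complex mat \<Rightarrow> rat_fun mat" where
  "const_mat A = map_mat (\<lambda>c. Fract [:c:] 1) A"

text \<open>Since matrices carry their dimensions, sums need the dimensions explicitly.\<close>

definition mat_sum :: "nat \<Rightarrow> nat \<Rightarrow> ('i \<Rightarrow> 'a :: comm_monoid_add mat) \<Rightarrow> 'i set \<Rightarrow> 'a mat" where
  "mat_sum p m f I = mat p m (\<lambda>ij. \<Sum>k\<in>I. f k $$ ij)"

text \<open>Block column and block row built from \<open>r\<close> blocks \<open>C 0, \<dots>, C (r - 1)\<close> of size \<open>p \<times> m\<close>.\<close>

definition block_column :: "nat \<Rightarrow> nat \<Rightarrow> nat \<Rightarrow> (nat \<Rightarrow> 'a mat) \<Rightarrow> 'a mat" where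
  "block_column r p m C = mat (r * p) m (\<lambda>(i, j). C (i div p) $$ (i mod p, j))"

definition block_row :: "nat \<Rightarrow> nat \<Rightarrow> nat \<Rightarrow> (nat \<Rightarrow> 'a mat) \<Rightarrow> 'a mat" where
  "block_row r p m C = mat p (r * m) (\<lambda>(i, j). C (j div m) $$ (i, j mod m))"

text \<open>
  The \<open>p \<times> m\<close>-valued Laurent polynomial
  \<open>z\<^sup>e (z\<^sup>-\<^sup>s C\<^sub>1 + z\<^sup>-\<^sup>2\<^sup>s C\<^sub>2 + \<dots> + z\<^sup>-\<^sup>N\<^sup>s C\<^sub>N)\<close>.
\<close>

definition laurent_mat ::
    "nat \<Rightarrow> nat \<Rightarrow> int \<Rightarrow> int \<Rightarrow> nat \<Rightarrow> (nat \<Rightarrow> complex mat) \<Rightarrow> rat_fun mat" where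
  "laurent_mat p m e s N C =
     rat_z powi e \<cdot>\<^sub>m mat_sum p m (\<lambda>k. rat_z powi (- (int k * s)) \<cdot>\<^sub>m const_mat (C k)) {1..N}"

end

theory Submission
  imports Defs "Jordan_Normal_Form.Determinant"
begin

text \<open>
  The reason is a polyphase decomposition. Collect the terms of
  \<open>F(z) = z\<^sup>q (z\<^sup>-\<^sup>1 B\<^sub>1 + \<dots> + z\<^sup>-\<^sup>n B\<^sub>n)\<close> according to the residue of their index modulo
  \<open>\<rho>\<close>. For \<open>\<gamma> = 1\<close>, each residue class sums, up to a power of \<open>z\<close>, to one block of the block
  column \<open>G(z)\<close>, which is itself a function of \<open>z\<^sup>\<rho>\<close>. Averaging \<open>F(\<omega> z)\<^sup>* F(\<omega> z)\<close> over the \<open>\<rho>\<close>-th roots of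
  unity \<open>\<omega>\<close> cancels the products of blocks from different residue classes and leaves the sum of
  the blocks' own products, which is \<open>G\<^sup>* G\<close> (\<open>circle_average_blocks\<close>). If \<open>F\<close> is an isometry
  on the circle, all averaged terms equal the identity, hence so does \<open>G\<^sup>* G\<close>. Replacing \<open>z\<close> by
  \<open>z\<^sup>\<gamma>\<close> keeps the circle invariant and yields arbitrary \<open>\<gamma>\<close>; the prefactor \<open>z\<^sup>a\<^sup>\<rho>\<close> is
  unimodular and plays no role (\<open>isometric_block_column\<close>).

  The class of isometries and co-isometries is invariant under transposition
  (\<open>class_U_transpose_iff\<close>), which turns block rows into block columns, so the statement on block
  rows follows from the one on block columns. A square isometry is also a co-isometry because a one-sided inverse of a square matrix
  is two-sided.
\<close>

section \<open>Values of rational functions\<close>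

text \<open>The rational function \<open>r\<close> is regular at \<open>z\<close> and takes the value \<open>v\<close> there.\<close>

definition has_value :: "rat_fun \<Rightarrow> complex \<Rightarrow> complex \<Rightarrow> bool" where
  "has_value r z v \<longleftrightarrow> (\<exists>P Q. r = Fract P Q \<and> poly Q z \<noteq> 0 \<and> v = poly P z / poly Q z)"

lemma has_value_regular: "has_value r z v \<Longrightarrow> regular_at r z"
  unfolding has_value_def regular_at_def by blast

lemma has_value_eval: "has_value r z v \<Longrightarrow> rat_eval r z = v"
  unfolding has_value_def using rat_eval_Fract by blast

lemma has_value_add:
  assumes "has_value r z v" "has_value s z w"
  shows "has_value (r + s) z (v + w)"
proof -
  obtain P Q P' Q' where *: "r = Fract P Q" "poly Q z \<noteq> 0" "v = poly P z / poly Q z"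
    "s = Fract P' Q'" "poly Q' z \<noteq> 0" "w = poly P' z / poly Q' z"
    using assms unfolding has_value_def by blast
  then have "Q \<noteq> 0" "Q' \<noteq> 0"
    by auto
  then have "r + s = Fract (P * Q' + P' * Q) (Q * Q')"
    using * by simp
  then show ?thesis
    unfolding has_value_def using * by (intro exI) (auto simp: add_frac_eq)
qed

lemma has_value_mult:
  assumes "has_value r z v" "has_value s z w"
  shows "has_value (r * s) z (v * w)"
proof -
  obtain P Q P' Q' where *: "r = Fract P Q" "poly Q z \<noteq> 0" "v = poly P z / poly Q z"
    "s = Fract P' Q'" "poly Q' z \<noteq> 0" "w = poly P' z / poly Q' z"
    using assms unfolding has_value_def by blast
  then have "r * s = Fract (P * P') (Q * Q')"
    by simp
  then show ?thesis
    unfolding has_value_def using * by (intro exI) auto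
qed

lemma has_value_inverse:
  assumes "has_value r z v" "v \<noteq> 0"
  shows "has_value (inverse r) z (inverse v)"
proof -
  obtain P Q where *: "r = Fract P Q" "poly Q z \<noteq> 0" "v = poly P z / poly Q z"
    using assms unfolding has_value_def by blast
  then show ?thesis
    unfolding has_value_def using assms(2) by (intro exI[of _ Q] exI[of _ P]) auto
qed

lemma has_value_const: "has_value (Fract [:c:] 1) z c"
  unfolding has_value_def by (intro exI[of _ "[:c:]"] exI[of _ 1]) auto

lemma has_value_0: "has_value 0 z 0"
  using has_value_const[of 0 z] by (simp add: Zero_fract_def)

lemma has_value_1: "has_value 1 z 1"
  using has_value_const[of 1 z] by (simp add: One_fract_def one_pCons)

lemma has_value_z: "has_value rat_z z z"
  unfolding has_value_def rat_z_def by (intro exI[of _ "[:0, 1:]"] exI[of _ 1]) auto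

lemma has_value_power: "has_value r z v \<Longrightarrow> has_value (r ^ n) z (v ^ n)"
  by (induction n) (auto intro: has_value_1 has_value_mult)

lemma has_value_power_int:
  assumes "has_value r z v" "v \<noteq> 0"
  shows "has_value (r powi e) z (v powi e)"
  using assms by (auto simp: power_int_def intro: has_value_power has_value_inverse)

lemma has_value_sum:
  assumes "\<And>k. k \<in> I \<Longrightarrow> has_value (f k) z (g k)"
  shows "has_value (\<Sum>k\<in>I. f k) z (\<Sum>k\<in>I. g k)"
  using assms by (induction I rule: infinite_finite_induct) (auto intro: has_value_0 has_value_add)

section \<open>Isometric Laurent polynomials\<close>

lemma laurent_mat_carrier: "laurent_mat p m e s N C \<in> carrier_mat p m"
  unfolding laurent_mat_def mat_sum_def by simp

lemma has_value_laurent_mat: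
  assumes "\<And>k. k \<in> {1..N} \<Longrightarrow> C k \<in> carrier_mat p m" "i < p" "j < m" "z \<noteq> 0"
  shows "has_value (laurent_mat p m e s N C $$ (i, j)) z
           (z powi e * (\<Sum>k\<in>{1..N}. z powi (- (int k * s)) * C k $$ (i, j)))"
proof -
  have "laurent_mat p m e s N C $$ (i, j)
      = rat_z powi e * (\<Sum>k\<in>{1..N}. (rat_z powi (- (int k * s)) \<cdot>\<^sub>m const_mat (C k)) $$ (i, j))"
    using assms unfolding laurent_mat_def mat_sum_def by simp
  also have "(\<Sum>k\<in>{1..N}. (rat_z powi (- (int k * s)) \<cdot>\<^sub>m const_mat (C k)) $$ (i, j))
      = (\<Sum>k\<in>{1..N}. rat_z powi (- (int k * s)) * Fract [:C k $$ (i, j):] 1)"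
  proof (rule sum.cong)
    fix k assume "k \<in> {1..N}"
    then have "C k \<in> carrier_mat p m"
      using assms(1) by blast
    then show "(rat_z powi (- (int k * s)) \<cdot>\<^sub>m const_mat (C k)) $$ (i, j)
        = rat_z powi (- (int k * s)) * Fract [:C k $$ (i, j):] 1"
      using assms(2,3) by (simp add: const_mat_def)
  qed simp
  finally show ?thesis
    using assms(4)
    by (auto intro!: has_value_mult has_value_sum has_value_power_int has_value_z has_value_const)
qed

lemma mat_adjoint_carrier: "A \<in> carrier_mat p m \<Longrightarrow> mat_adjoint A \<in> carrier_mat m p"
  unfolding mat_adjoint_def by (auto simp: mat_of_rows_def)

lemma mat_adjoint_index:
  "A \<in> carrier_mat p m \<Longrightarrow> i < m \<Longrightarrow> j < p \<Longrightarrow> mat_adjoint A $$ (i, j) = conjugate (A $$ (j, i))"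
  unfolding mat_adjoint_def by (auto simp: mat_of_rows_def)

lemma adjoint_mult_index:
  fixes A :: "complex mat"
  assumes A: "A \<in> carrier_mat p m" and j: "j < m" "j' < m"
  shows "(mat_adjoint A * A) $$ (j, j') = (\<Sum>i<p. cnj (A $$ (i, j)) * A $$ (i, j'))"
proof -
  have "(mat_adjoint A * A) $$ (j, j') = row (mat_adjoint A) j \<bullet> col A j'"
    using A j mat_adjoint_carrier[OF A] by simp
  also have "\<dots> = (\<Sum>i<p. cnj (A $$ (i, j)) * A $$ (i, j'))"
    using A j mat_adjoint_carrier[OF A]
    by (auto simp: scalar_prod_def mat_adjoint_index[OF A] lessThan_atLeast0 intro!: sum.cong)
  finally show ?thesis .
qed

text \<open>
  On the circle \<open>cnj z = inverse z\<close>, so in \<open>F(z)\<^sup>* F(z)\<close> the prefactor \<open>z\<^sup>e\<close> disappears and what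
  remains is a trigonometric polynomial in the products of the coefficients.
\<close>

lemma isometric_laurent_iff:
  assumes C: "\<And>k. k \<in> {1..N} \<Longrightarrow> C k \<in> carrier_mat p m"
  shows "isometric_on_circle (laurent_mat p m e s N C) \<longleftrightarrow>
    (\<forall>z. cmod z = 1 \<longrightarrow> (\<forall>j<m. \<forall>j'<m.
       (\<Sum>k\<in>{1..N}. \<Sum>l\<in>{1..N}.
          (\<Sum>i<p. cnj (C k $$ (i, j)) * C l $$ (i, j')) * z powi (s * (int k - int l)))
       = (if j = j' then 1 else 0)))"
proof -
  define F where "F = laurent_mat p m e s N C"
  have F: "F \<in> carrier_mat p m"
    unfolding F_def by (rule laurent_mat_carrier)
  have iff: "mat_regular_at F z \<and> mat_adjoint (mat_eval F z) * mat_eval F z = 1\<^sub>m (dim_col F)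
    \<longleftrightarrow> (\<forall>j<m. \<forall>j'<m. (\<Sum>k\<in>{1..N}. \<Sum>l\<in>{1..N}.
          (\<Sum>i<p. cnj (C k $$ (i, j)) * C l $$ (i, j')) * z powi (s * (int k - int l)))
       = (if j = j' then 1 else 0))" if z: "cmod z = 1" for z
  proof -
    have z0: "z \<noteq> 0" using z by auto
    have cnjz: "cnj z = inverse z"
      using z by (metis complex_div_cnj complex_mod_mult_cnj divide_inverse inverse_unique
          complex_norm_square mult_1 of_real_1 power_one)
    have hv: "has_value (F $$ (i, j)) z
        (z powi e * (\<Sum>k\<in>{1..N}. z powi (- (int k * s)) * C k $$ (i, j)))"
      if "i < p" "j < m" for i j
      unfolding F_def using has_value_laurent_mat[OF C that z0] .
    have reg: "mat_regular_at F z"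
      unfolding mat_regular_at_def using F hv has_value_regular by blast
    have E: "mat_eval F z \<in> carrier_mat p m"
      using F unfolding mat_eval_def by simp
    have ev: "mat_eval F z $$ (i, j) = z powi e * (\<Sum>k\<in>{1..N}. z powi (- (int k * s)) * C k $$ (i, j))"
      if "i < p" "j < m" for i j
      using F that has_value_eval[OF hv[OF that]] unfolding mat_eval_def by simp
    have cnjp: "cnj (z powi d) = z powi (- d)" for d
      using cnjz by (simp add: power_int_def)
    have pw: "cnj (z powi e * z powi (- (int k * s))) * (z powi e * z powi (- (int l * s)))
        = z powi (s * (int k - int l))" for k l
    proof -
      have "cnj (z powi e * z powi (- (int k * s))) = z powi (- e) * z powi (int k * s)"
        by (simp only: complex_cnj_mult cnjp minus_minus)
      then have "cnj (z powi e * z powi (- (int k * s))) * (z powi e * z powi (- (int l * s)))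
          = z powi (- e + int k * s + (e + - (int l * s)))"
        using z0 by (simp only: power_int_add simp_thms)
      also have "- e + int k * s + (e + - (int l * s)) = s * (int k - int l)"
        by (simp add: algebra_simps)
      finally show ?thesis .
    qed
    have entry: "(mat_adjoint (mat_eval F z) * mat_eval F z) $$ (j, j') =
        (\<Sum>k\<in>{1..N}. \<Sum>l\<in>{1..N}.
          (\<Sum>i<p. cnj (C k $$ (i, j)) * C l $$ (i, j')) * z powi (s * (int k - int l)))"
      if j: "j < m" "j' < m" for j j'
    proof -
      have "(mat_adjoint (mat_eval F z) * mat_eval F z) $$ (j, j')
          = (\<Sum>i<p. (\<Sum>k\<in>{1..N}. cnj (z powi e * z powi (- (int k * s))) * cnj (C k $$ (i, j)))
              * (\<Sum>l\<in>{1..N}. z powi e * z powi (- (int l * s)) * C l $$ (i, j')))"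
        using j by (simp add: adjoint_mult_index[OF E] ev sum_distrib_left mult.assoc)
      also have "\<dots> = (\<Sum>i<p. \<Sum>k\<in>{1..N}. \<Sum>l\<in>{1..N}.
          cnj (C k $$ (i, j)) * C l $$ (i, j') *
          (cnj (z powi e * z powi (- (int k * s))) * (z powi e * z powi (- (int l * s)))))"
        by (simp only: sum_product) (simp only: mult_ac)
      also have "\<dots> = (\<Sum>i<p. \<Sum>k\<in>{1..N}. \<Sum>l\<in>{1..N}.
          cnj (C k $$ (i, j)) * C l $$ (i, j') * z powi (s * (int k - int l)))"
        unfolding pw ..
      also have "\<dots> = (\<Sum>k\<in>{1..N}. \<Sum>i<p. \<Sum>l\<in>{1..N}.
          cnj (C k $$ (i, j)) * C l $$ (i, j') * z powi (s * (int k - int l)))"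
        by (rule sum.swap)
      also have "\<dots> = (\<Sum>k\<in>{1..N}. \<Sum>l\<in>{1..N}. \<Sum>i<p.
          cnj (C k $$ (i, j)) * C l $$ (i, j') * z powi (s * (int k - int l)))"
        by (intro sum.cong refl sum.swap)
      finally show ?thesis
        by (simp only: sum_distrib_right)
    qed
    have "mat_adjoint (mat_eval F z) * mat_eval F z = 1\<^sub>m (dim_col F) \<longleftrightarrow>
      (\<forall>j<m. \<forall>j'<m. (mat_adjoint (mat_eval F z) * mat_eval F z) $$ (j, j')
         = (if j = j' then 1 else 0))"
      using F E mat_adjoint_carrier[OF E] by (auto simp: mat_eq_iff)
    then show ?thesis
      using reg entry by simp
  qed
  show ?thesis
    unfolding isometric_on_circle_def F_def[symmetric] using iff by blast
qed

section \<open>Averaging over roots of unity\<close>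

lemma sum_root_unity_power_int:
  fixes \<rho> :: nat and d :: int
  assumes "\<rho> \<ge> 1"
  shows "(\<Sum>t<\<rho>. cis (2 * pi * real t / real \<rho>) powi d) = (if int \<rho> dvd d then of_nat \<rho> else 0)"
proof -
  define x where "x = cis (2 * pi * real_of_int d / real \<rho>)"
  have pow: "cis (2 * pi * real t / real \<rho>) powi d = x ^ t" for t
    unfolding x_def by (simp add: cis_power_int Complex.DeMoivre mult_ac)
  have x\<rho>: "x ^ \<rho> = 1"
    unfolding x_def using assms by (simp add: Complex.DeMoivre)
  have x1: "x = 1 \<longleftrightarrow> int \<rho> dvd d"
  proof
    assume "x = 1"
    then have "cos (2 * pi * real_of_int d / real \<rho>) = 1"
      unfolding x_def by (metis cis.sel(1) one_complex.sel(1))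
    then obtain k :: int where "2 * pi * real_of_int d / real \<rho> = of_int k * 2 * pi"
      using cos_one_2pi_int by blast
    then have "real_of_int d = real_of_int (k * int \<rho>)"
      using assms by (simp add: field_simps)
    then have "d = k * int \<rho>"
      by linarith
    then show "int \<rho> dvd d"
      by simp
  next
    assume "int \<rho> dvd d"
    then obtain k where "d = int \<rho> * k" ..
    then have "2 * pi * real_of_int d / real \<rho> = 2 * pi * real_of_int k"
      using assms by simp
    then show "x = 1"
      unfolding x_def by (simp only: cis_multiple_2pi Ints_of_int)
  qed
  show ?thesis
    unfolding pow using x\<rho> x1 by (auto simp: geometric_sum)
qed

lemma sum_blocks:
  fixes f :: "nat \<Rightarrow> 'a :: comm_monoid_add"
  shows "(\<Sum>k\<in>{1..N * \<rho>}. f k) = (\<Sum>K\<in>{1..N}. \<Sum>r<\<rho>. f ((K - 1) * \<rho> + r + 1))"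
proof (induction N)
  case (Suc N)
  have "{1..Suc N * \<rho>} = {1..N * \<rho>} \<union> (\<lambda>r. N * \<rho> + r + 1) ` {..<\<rho>}"
  proof (intro equalityI subsetI)
    fix k assume k: "k \<in> {1..Suc N * \<rho>}"
    show "k \<in> {1..N * \<rho>} \<union> (\<lambda>r. N * \<rho> + r + 1) ` {..<\<rho>}"
    proof (cases "k \<le> N * \<rho>")
      case False
      then have "k = N * \<rho> + (k - N * \<rho> - 1) + 1" "k - N * \<rho> - 1 < \<rho>"
        using k by auto
      then show ?thesis
        by blast
    qed (use k in auto)
  qed auto
  then have "(\<Sum>k\<in>{1..Suc N * \<rho>}. f k)
      = (\<Sum>k\<in>{1..N * \<rho>}. f k) + (\<Sum>k\<in>(\<lambda>r. N * \<rho> + r + 1) ` {..<\<rho>}. f k)"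
    by (simp only:) (rule sum.union_disjoint, auto)
  also have "(\<Sum>k\<in>(\<lambda>r. N * \<rho> + r + 1) ` {..<\<rho>}. f k) = (\<Sum>r<\<rho>. f (N * \<rho> + r + 1))"
    by (subst sum.reindex) (auto simp: inj_on_def)
  finally show ?case
    using Suc.IH by simp
qed simp

lemma dvd_block_difference_iff:
  fixes r s \<rho> :: nat
  assumes "r < \<rho>" "s < \<rho>"
  shows "int \<rho> dvd int \<rho> * d + (int r - int s) \<longleftrightarrow> r = s"
proof -
  have "int \<rho> dvd int \<rho> * d + (int r - int s) \<longleftrightarrow> int \<rho> dvd int r - int s"
    by (rule dvd_add_right_iff) simp
  also have "\<dots> \<longleftrightarrow> int r mod int \<rho> = int s mod int \<rho>"
    by (simp add: mod_eq_dvd_iff)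
  finally show ?thesis
    using assms by simp
qed

text \<open>
  Averaging over the points \<open>\<omega> z\<close> with \<open>\<omega>\<^sup>\<rho> = 1\<close> removes every term with \<open>k \<noteq> l\<close> modulo \<open>\<rho>\<close>.
\<close>

lemma circle_average_blocks:
  fixes c :: "nat \<Rightarrow> nat \<Rightarrow> complex"
  assumes \<rho>: "\<rho> \<ge> 1"
    and const: "\<And>z. cmod z = 1 \<Longrightarrow>
      (\<Sum>k\<in>{1..N * \<rho>}. \<Sum>l\<in>{1..N * \<rho>}. c k l * z powi (int k - int l)) = v"
    and z: "cmod z = 1"
  shows "(\<Sum>K\<in>{1..N}. \<Sum>L\<in>{1..N}. (\<Sum>r<\<rho>. c ((K - 1) * \<rho> + r + 1) ((L - 1) * \<rho> + r + 1))
            * z powi (int \<rho> * (int K - int L))) = v"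
proof -
  define \<omega> where "\<omega> t = cis (2 * pi * real t / real \<rho>)" for t
  define S where "S d = (\<Sum>t<\<rho>. \<omega> t powi d)" for d
  have S: "S d = (if int \<rho> dvd d then of_nat \<rho> else 0)" for d
    unfolding S_def \<omega>_def using sum_root_unity_power_int[OF \<rho>] .
  have "of_nat \<rho> * v = (\<Sum>t<\<rho>. \<Sum>k\<in>{1..N * \<rho>}. \<Sum>l\<in>{1..N * \<rho>}.
      c k l * (\<omega> t * z) powi (int k - int l))"
    using const z by (simp add: \<omega>_def norm_mult)
  also have "\<dots> = (\<Sum>k\<in>{1..N * \<rho>}. \<Sum>l\<in>{1..N * \<rho>}. \<Sum>t<\<rho>.
      c k l * (\<omega> t * z) powi (int k - int l))"
    by (subst sum.swap) (intro sum.cong refl sum.swap)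
  also have "\<dots> = (\<Sum>k\<in>{1..N * \<rho>}. \<Sum>l\<in>{1..N * \<rho>}.
      c k l * z powi (int k - int l) * S (int k - int l))"
    unfolding S_def sum_distrib_left power_int_mult_distrib by (simp only: mult_ac)
  also have "\<dots> = (\<Sum>K\<in>{1..N}. \<Sum>r<\<rho>. \<Sum>L\<in>{1..N}. \<Sum>s<\<rho>.
      c ((K - 1) * \<rho> + r + 1) ((L - 1) * \<rho> + s + 1)
        * z powi (int ((K - 1) * \<rho> + r + 1) - int ((L - 1) * \<rho> + s + 1))
        * S (int ((K - 1) * \<rho> + r + 1) - int ((L - 1) * \<rho> + s + 1)))"
    unfolding sum_blocks ..
  also have "\<dots> = (\<Sum>K\<in>{1..N}. \<Sum>r<\<rho>. \<Sum>L\<in>{1..N}. \<Sum>s<\<rho>.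
      if r = s then of_nat \<rho> * (c ((K - 1) * \<rho> + r + 1) ((L - 1) * \<rho> + s + 1)
        * z powi (int \<rho> * (int K - int L))) else 0)"
  proof (intro sum.cong refl)
    fix K L r s
    assume *: "K \<in> {1..N}" "L \<in> {1..N}" "r \<in> {..<\<rho>}" "s \<in> {..<\<rho>}"
    have d: "int ((K - 1) * \<rho> + r + 1) - int ((L - 1) * \<rho> + s + 1)
        = int \<rho> * (int K - int L) + (int r - int s)"
    proof -
      obtain K' L' where "K = Suc K'" "L = Suc L'"
        using *(1,2) by (metis Suc_pred' atLeastAtMost_iff less_eq_Suc_le One_nat_def)
      then show ?thesis
        by (simp add: algebra_simps)
    qed
    show "c ((K - 1) * \<rho> + r + 1) ((L - 1) * \<rho> + s + 1)
        * z powi (int ((K - 1) * \<rho> + r + 1) - int ((L - 1) * \<rho> + s + 1))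
        * S (int ((K - 1) * \<rho> + r + 1) - int ((L - 1) * \<rho> + s + 1))
      = (if r = s then of_nat \<rho> * (c ((K - 1) * \<rho> + r + 1) ((L - 1) * \<rho> + s + 1)
        * z powi (int \<rho> * (int K - int L))) else 0)"
      unfolding d S using dvd_block_difference_iff[of r \<rho> s "int K - int L"] * by auto
  qed
  also have "\<dots> = (\<Sum>K\<in>{1..N}. \<Sum>r<\<rho>. \<Sum>L\<in>{1..N}.
      of_nat \<rho> * (c ((K - 1) * \<rho> + r + 1) ((L - 1) * \<rho> + r + 1)
        * z powi (int \<rho> * (int K - int L))))"
    by (intro sum.cong refl) simp
  also have "\<dots> = (\<Sum>K\<in>{1..N}. \<Sum>L\<in>{1..N}. \<Sum>r<\<rho>.
      of_nat \<rho> * (c ((K - 1) * \<rho> + r + 1) ((L - 1) * \<rho> + r + 1)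
        * z powi (int \<rho> * (int K - int L))))"
    by (intro sum.cong refl sum.swap)
  also have "\<dots> = of_nat \<rho> * (\<Sum>K\<in>{1..N}. \<Sum>L\<in>{1..N}.
      (\<Sum>r<\<rho>. c ((K - 1) * \<rho> + r + 1) ((L - 1) * \<rho> + r + 1))
        * z powi (int \<rho> * (int K - int L)))"
    by (simp only: sum_distrib_left sum_distrib_right)
  finally show ?thesis
    using \<rho> by simp
qed

section \<open>Block columns\<close>

lemma block_column_carrier: "block_column r p m C \<in> carrier_mat (r * p) m"
  unfolding block_column_def by simp

lemma block_column_column_product:
  fixes C D :: "nat \<Rightarrow> complex mat"
  assumes "j < m" "j' < m"
  shows "(\<Sum>i<r * p. cnj (block_column r p m C $$ (i, j)) * block_column r p m D $$ (i, j'))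
       = (\<Sum>t<r. \<Sum>i<p. cnj (C t $$ (i, j)) * D t $$ (i, j'))"
proof -
  have "(\<Sum>i<r * p. cnj (block_column r p m C $$ (i, j)) * block_column r p m D $$ (i, j'))
      = (\<Sum>i<r * p. cnj (C (i div p) $$ (i mod p, j)) * D (i div p) $$ (i mod p, j'))"
    using assms by (intro sum.cong) (auto simp: block_column_def)
  also have "\<dots> = (\<Sum>t<r. \<Sum>i\<in>{t * p..<t * p + p}.
      cnj (C (i div p) $$ (i mod p, j)) * D (i div p) $$ (i mod p, j'))"
    by (rule sum.nat_group[symmetric])
  also have "\<dots> = (\<Sum>t<r. \<Sum>i<p. cnj (C t $$ (i, j)) * D t $$ (i, j'))"
  proof (rule sum.cong[OF refl])
    fix t
    have "(\<Sum>i\<in>{t * p..<t * p + p}.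
        cnj (C (i div p) $$ (i mod p, j)) * D (i div p) $$ (i mod p, j'))
      = (\<Sum>i\<in>{0..<p}. cnj (C ((i + t * p) div p) $$ ((i + t * p) mod p, j))
          * D ((i + t * p) div p) $$ ((i + t * p) mod p, j'))"
      using sum.shift_bounds_nat_ivl[of "\<lambda>i. cnj (C (i div p) $$ (i mod p, j))
          * D (i div p) $$ (i mod p, j')" 0 "t * p" p] by (simp add: add.commute)
    also have "\<dots> = (\<Sum>i\<in>{0..<p}. cnj (C t $$ (i, j)) * D t $$ (i, j'))"
      by (intro sum.cong) auto
    finally show "(\<Sum>i\<in>{t * p..<t * p + p}.
        cnj (C (i div p) $$ (i mod p, j)) * D (i div p) $$ (i mod p, j'))
      = (\<Sum>i<p. cnj (C t $$ (i, j)) * D t $$ (i, j'))"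
      by (simp add: lessThan_atLeast0)
  qed
  finally show ?thesis .
qed

lemma isometric_block_column:
  assumes B: "\<And>k. k \<in> {1..N * \<rho>} \<Longrightarrow> B k \<in> carrier_mat p m"
    and \<rho>: "\<rho> \<ge> 1"
    and iso: "isometric_on_circle (laurent_mat p m q 1 (N * \<rho>) B)"
  shows "isometric_on_circle (laurent_mat (\<rho> * p) m e (int \<gamma> * int \<rho>) N
           (\<lambda>k. block_column \<rho> p m (\<lambda>i. B ((k - 1) * \<rho> + i + 1))))"
proof -
  let ?B = "\<lambda>k. block_column \<rho> p m (\<lambda>i. B ((k - 1) * \<rho> + i + 1))"
  have "(\<Sum>k\<in>{1..N}. \<Sum>l\<in>{1..N}. (\<Sum>i<\<rho> * p. cnj (?B k $$ (i, j)) * ?B l $$ (i, j'))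
        * z powi (int \<gamma> * int \<rho> * (int k - int l))) = (if j = j' then 1 else 0)"
    if z: "cmod z = 1" and j: "j < m" "j' < m" for z j j'
  proof -
    define c where "c k l = (\<Sum>i<p. cnj (B k $$ (i, j)) * B l $$ (i, j'))" for k l
    have "(\<Sum>k\<in>{1..N * \<rho>}. \<Sum>l\<in>{1..N * \<rho>}. c k l * w powi (int k - int l))
        = (if j = j' then 1 else 0)" if "cmod w = 1" for w
      using isometric_laurent_iff[where C = B and N = "N * \<rho>" and s = 1, OF B]
        iso that j unfolding c_def mult_1_left by blast
    \<comment> \<open>The variable of the block polynomial is \<open>z\<^sup>\<gamma>\<^sup>\<rho>\<close>, so the average is taken around \<open>z\<^sup>\<gamma>\<close>.\<close>
    from circle_average_blocks[where N = N and c = c and z = "z ^ \<gamma>", OF \<rho> this] z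
    have "(\<Sum>K\<in>{1..N}. \<Sum>L\<in>{1..N}.
        (\<Sum>r<\<rho>. c ((K - 1) * \<rho> + r + 1) ((L - 1) * \<rho> + r + 1))
          * (z ^ \<gamma>) powi (int \<rho> * (int K - int L))) = (if j = j' then 1 else 0)"
      by (simp add: norm_power)
    then show ?thesis
      unfolding block_column_column_product[OF j] by (simp add: c_def power_int_power mult.assoc)
  qed
  then show ?thesis
    by (subst isometric_laurent_iff) (auto simp: block_column_carrier)
qed

section \<open>The class of isometries and co-isometries\<close>

lemma mat_eval_carrier: "F \<in> carrier_mat p m \<Longrightarrow> mat_eval F z \<in> carrier_mat p m"
  unfolding mat_eval_def by simp

lemma isometric_transpose_iff: "isometric_on_circle (transpose_mat F) \<longleftrightarrow> coisometric_on_circle F"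
proof -
  have reg: "mat_regular_at (transpose_mat F) z \<longleftrightarrow> mat_regular_at F z" for z
    unfolding mat_regular_at_def by auto
  have "mat_adjoint (mat_eval (transpose_mat F) z) * mat_eval (transpose_mat F) z
      = transpose_mat (mat_eval F z * mat_adjoint (mat_eval F z))" for z
  proof -
    have A: "mat_eval F z \<in> carrier_mat (dim_row F) (dim_col F)"
      by (rule mat_eval_carrier) simp
    have T: "mat_eval (transpose_mat F) z = transpose_mat (mat_eval F z)"
      unfolding mat_eval_def by (rule map_mat_transpose[symmetric])
    have "mat_adjoint (transpose_mat (mat_eval F z)) = transpose_mat (mat_adjoint (mat_eval F z))"
      using A mat_adjoint_carrier[OF A] mat_adjoint_carrier[OF transpose_carrier_mat[THEN iffD2, OF A]]
      by (intro eq_matI)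
        (auto simp: mat_adjoint_index[OF A]
          mat_adjoint_index[OF transpose_carrier_mat[THEN iffD2, OF A]])
    then show ?thesis
      unfolding T using transpose_mult[OF A mat_adjoint_carrier[OF A]] by simp
  qed
  then show ?thesis
    unfolding isometric_on_circle_def coisometric_on_circle_def reg
    by (metis index_transpose_mat(3) transpose_one Matrix.transpose_transpose)
qed

lemma coisometric_transpose_iff: "coisometric_on_circle (transpose_mat F) \<longleftrightarrow> isometric_on_circle F"
  using isometric_transpose_iff[of "transpose_mat F"] by simp

lemma class_U_transpose_iff: "transpose_mat F \<in> class_U \<longleftrightarrow> F \<in> class_U"
  unfolding class_U_def by (auto simp: isometric_transpose_iff coisometric_transpose_iff)

lemma isometric_imp_coisometric:
  assumes "isometric_on_circle F" "dim_row F = dim_col F"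
  shows "coisometric_on_circle F"
proof -
  have A: "mat_eval F z \<in> carrier_mat (dim_row F) (dim_row F)" for z
    by (rule mat_eval_carrier) (use assms(2) in auto)
  show ?thesis
    using assms mat_mult_left_right_inverse[OF mat_adjoint_carrier[OF A] A]
    unfolding isometric_on_circle_def coisometric_on_circle_def by simp
qed

lemma class_U_isometricI:
  assumes "isometric_on_circle F" "dim_col F \<le> dim_row F"
  shows "F \<in> class_U"
  using assms isometric_imp_coisometric[of F] unfolding class_U_def by auto

lemma class_U_block_column:
  assumes "\<And>k. k \<in> {1..N * \<rho>} \<Longrightarrow> B k \<in> carrier_mat p m" "\<rho> \<ge> 1" "m \<le> p"
    and U: "laurent_mat p m q 1 (N * \<rho>) B \<in> class_U"
  shows "laurent_mat (\<rho> * p) m e (int \<gamma> * int \<rho>) N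
           (\<lambda>k. block_column \<rho> p m (\<lambda>i. B ((k - 1) * \<rho> + i + 1))) \<in> class_U"
proof (rule class_U_isometricI)
  have "isometric_on_circle (laurent_mat p m q 1 (N * \<rho>) B)"
    using U assms(3) laurent_mat_carrier[of p m q 1 "N * \<rho>" B] unfolding class_U_def by auto
  then show "isometric_on_circle (laurent_mat (\<rho> * p) m e (int \<gamma> * int \<rho>) N
           (\<lambda>k. block_column \<rho> p m (\<lambda>i. B ((k - 1) * \<rho> + i + 1))))"
    using isometric_block_column assms(1,2) by blast
  have "m \<le> \<rho> * p"
    using mult_le_mono[OF assms(2,3)] by simp
  then show "dim_col (laurent_mat (\<rho> * p) m e (int \<gamma> * int \<rho>) N
           (\<lambda>k. block_column \<rho> p m (\<lambda>i. B ((k - 1) * \<rho> + i + 1))))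
      \<le> dim_row (laurent_mat (\<rho> * p) m e (int \<gamma> * int \<rho>) N
           (\<lambda>k. block_column \<rho> p m (\<lambda>i. B ((k - 1) * \<rho> + i + 1))))"
    unfolding laurent_mat_carrier[THEN carrier_matD(1)] laurent_mat_carrier[THEN carrier_matD(2)] .
qed

section \<open>Block rows by transposition\<close>

lemma transpose_laurent_mat:
  assumes "\<And>k. k \<in> {1..N} \<Longrightarrow> C k \<in> carrier_mat p m"
    and "\<And>k. k \<in> {1..N} \<Longrightarrow> D k = transpose_mat (C k)"
  shows "transpose_mat (laurent_mat p m e s N C) = laurent_mat m p e s N D"
proof (rule eq_matI)
  fix i j
  assume "i < dim_row (laurent_mat m p e s N D)" "j < dim_col (laurent_mat m p e s N D)"
  then have ij: "i < m" "j < p"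
    using laurent_mat_carrier[of m p e s N D] by auto
  have "(\<Sum>k\<in>{1..N}. (rat_z powi (- (int k * s)) \<cdot>\<^sub>m const_mat (C k)) $$ (j, i))
      = (\<Sum>k\<in>{1..N}. (rat_z powi (- (int k * s)) \<cdot>\<^sub>m const_mat (D k)) $$ (i, j))"
  proof (rule sum.cong[OF refl])
    fix k assume k: "k \<in> {1..N}"
    show "(rat_z powi (- (int k * s)) \<cdot>\<^sub>m const_mat (C k)) $$ (j, i)
        = (rat_z powi (- (int k * s)) \<cdot>\<^sub>m const_mat (D k)) $$ (i, j)"
      using assms(1)[OF k] assms(2)[OF k] ij by (simp add: const_mat_def)
  qed
  then show "transpose_mat (laurent_mat p m e s N C) $$ (i, j) = laurent_mat m p e s N D $$ (i, j)"
    using ij unfolding laurent_mat_def mat_sum_def by simp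
qed (auto simp: laurent_mat_def mat_sum_def)

lemma block_row_carrier: "block_row r p m C \<in> carrier_mat p (r * m)"
  unfolding block_row_def by simp

lemma transpose_block_row:
  assumes "\<And>i. i < r \<Longrightarrow> C i \<in> carrier_mat p m"
  shows "transpose_mat (block_row r p m C) = block_column r m p (\<lambda>i. transpose_mat (C i))"
proof (rule eq_matI)
  fix i j
  assume "i < dim_row (block_column r m p (\<lambda>i. transpose_mat (C i)))"
    "j < dim_col (block_column r m p (\<lambda>i. transpose_mat (C i)))"
  then have ij: "i < r * m" "j < p"
    unfolding block_column_def by auto
  then have "m > 0"
    by (cases m) auto
  with ij have "i div m < r" "i mod m < m"
    by (auto simp: less_mult_imp_div_less)
  with ij assms[of "i div m"]
  show "transpose_mat (block_row r p m C) $$ (i, j)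
      = block_column r m p (\<lambda>i. transpose_mat (C i)) $$ (i, j)"
    unfolding block_row_def block_column_def by simp
qed (auto simp: block_row_def block_column_def)

lemma class_U_block_row:
  assumes B: "\<And>k. k \<in> {1..N * \<rho>} \<Longrightarrow> B k \<in> carrier_mat p m" and \<rho>: "\<rho> \<ge> 1" and "p \<le> m"
    and U: "laurent_mat p m q 1 (N * \<rho>) B \<in> class_U"
  shows "laurent_mat p (\<rho> * m) e (int \<gamma> * int \<rho>) N
           (\<lambda>k. block_row \<rho> p m (\<lambda>i. B ((k - 1) * \<rho> + i + 1))) \<in> class_U"
proof -
  let ?T = "\<lambda>k. transpose_mat (B k)"
  have "laurent_mat m p q 1 (N * \<rho>) ?T \<in> class_U"
    using U class_U_transpose_iff
      transpose_laurent_mat[where C = B and D = ?T and N = "N * \<rho>" and e = q and s = 1, OF B refl]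
    by metis
  then have "laurent_mat (\<rho> * m) p e (int \<gamma> * int \<rho>) N
      (\<lambda>k. block_column \<rho> m p (\<lambda>i. ?T ((k - 1) * \<rho> + i + 1))) \<in> class_U"
    using B \<rho> \<open>p \<le> m\<close> by (intro class_U_block_column) auto
  moreover have "transpose_mat (laurent_mat p (\<rho> * m) e (int \<gamma> * int \<rho>) N
        (\<lambda>k. block_row \<rho> p m (\<lambda>i. B ((k - 1) * \<rho> + i + 1))))
      = laurent_mat (\<rho> * m) p e (int \<gamma> * int \<rho>) N
          (\<lambda>k. block_column \<rho> m p (\<lambda>i. ?T ((k - 1) * \<rho> + i + 1)))"
  proof (rule transpose_laurent_mat)
    fix k assume k: "k \<in> {1..N}"
    have "B ((k - 1) * \<rho> + i + 1) \<in> carrier_mat p m" if "i < \<rho>" for i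
    proof (rule B)
      have "(k - 1) * \<rho> + i + 1 \<le> (k - 1) * \<rho> + \<rho>"
        using that by simp
      also have "\<dots> = k * \<rho>"
        using k by (cases k) auto
      also have "\<dots> \<le> N * \<rho>"
        using k by simp
      finally show "(k - 1) * \<rho> + i + 1 \<in> {1..N * \<rho>}"
        by simp
    qed
    then show "block_column \<rho> m p (\<lambda>i. ?T ((k - 1) * \<rho> + i + 1))
        = transpose_mat (block_row \<rho> p m (\<lambda>i. B ((k - 1) * \<rho> + i + 1)))"
      by (simp add: transpose_block_row)
  qed (rule block_row_carrier)
  ultimately show ?thesis
    using class_U_transpose_iff by metis
qed

theorem mainTheorem8:
  fixes p m n \<rho> \<gamma> :: nat and q a :: int and B :: "nat \<Rightarrow> complex mat"
  assumes B: "\<And>k. k \<in> {1..n} \<Longrightarrow> B k \<in> carrier_mat p m"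
    and \<rho>: "\<rho> \<ge> 1" "\<rho> dvd n"
    and \<gamma>: "\<gamma> \<ge> 1"
  defines "F \<equiv> laurent_mat p m q 1 n B"
    and "B_col \<equiv> (\<lambda>k. block_column \<rho> p m (\<lambda>i. B ((k - 1) * \<rho> + i + 1)))"
    and "B_row \<equiv> (\<lambda>k. block_row \<rho> p m (\<lambda>i. B ((k - 1) * \<rho> + i + 1)))"
  defines "G_col \<equiv> laurent_mat (\<rho> * p) m (a * int \<rho>) (int \<gamma> * int \<rho>) (n div \<rho>) B_col"
    and "G_row \<equiv> laurent_mat p (\<rho> * m) (a * int \<rho>) (int \<gamma> * int \<rho>) (n div \<rho>) B_row"
  shows "(p \<ge> m \<and> F \<in> class_U \<longrightarrow> G_col \<in> carrier_mat (\<rho> * p) m \<and> G_col \<in> class_U) \<and>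
         (m \<ge> p \<and> F \<in> class_U \<longrightarrow> G_row \<in> carrier_mat p (\<rho> * m) \<and> G_row \<in> class_U)"
proof -
  have n: "n div \<rho> * \<rho> = n"
    using \<rho>(2) by simp
  have "G_col \<in> class_U" if "m \<le> p" "F \<in> class_U"
    unfolding G_col_def B_col_def
    by (rule class_U_block_column[where q = q]) (use B \<rho>(1) n that F_def in auto)
  moreover have "G_row \<in> class_U" if "p \<le> m" "F \<in> class_U"
    unfolding G_row_def B_row_def
    by (rule class_U_block_row[where q = q]) (use B \<rho>(1) n that F_def in auto)
  ultimately show ?thesis
    unfolding G_col_def G_row_def using laurent_mat_carrier by blast
qed

end
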